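(* Let $\Sigma=(\sigma_n:G\to\mathrm{Sym}(V_n))_{n\ge1}$ be a sofic approximation to $G$, let $(\mathcal X^G,\mu,S,d)$ be a metric $G$-process, and let $\mu_n\in\mathrm{Prob}(\mathcal X^{V_n})$ for each $n\ge1$. If $(\mathcal X^G,\mu,S,d)$ is ergodic and $(\mu_n)_{n\ge1}$ locally weak$^\ast$ converges to $\mu$, then $(\mu_n)_{n\ge1}$ quenched converges to $\mu$.
   Context: $G$ is a countable discrete sofic group. A sofic approximation $\Sigma=(\sigma_n)_{n\ge1}$ to $G$ is a sequence of nonempty finite sets $V_n$ and maps $\sigma_n:G\to\mathrm{Sym}(V_n)$, $g\mapsto\sigma_n^g$ (not necessarily homomorphisms), such that for all $g,h\in G$ the proportion of $v\in V_n$ with $\sigma_n^g(\sigma_n^h(v))=\sigma_n^{gh}(v)$ tends to $1$, and for all $g\ne e$ the proportion of $v\in V_n$ with $\sigma_n^g(v)\neq v$ tends to $1$. A metric $G$-process $(\mathcal{X}^G,\mu,S,d)$ consists of a standard measurable space $\mathcal{X}$, a compact metric $d$ on $\mathcal X$ whose Borel $\sigma$-algebra is that of $\mathcal X$, the right-shift action $S^g((x_h)_{h})=(x_{hg})_{h}$, and an $S$-invariant probability measure $\mu$ on $\mathcal{X}^G$. $\mathcal{X}^G$ has the product topology from $d$, and $\mathrm{Prob}(\mathcal X^G)$ the resulting weak$^\ast$ topology. The process is ergodic if $\mu$ is ergodic for $S$. For $\sigma:G\to\mathrm{Sym}(V)$ with $V$ finite, $\mathbf{x}\in\mathcal{X}^V$,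 $v\in V$: $\Pi^\sigma_v(\mathbf{x})=(x_{\sigma^g(v)})_{g\in G}\in\mathcal{X}^G$; $P^\sigma_{\mathbf x}=\frac1{|V|}\sum_{v}\delta_{\Pi^\sigma_v(\mathbf x)}$; $\Omega(\mathcal O,\sigma)=\{\mathbf x\in\mathcal X^V: P^\sigma_{\mathbf x}\in\mathcal O\}$ for $\mathcal{O}\subseteq\mathrm{Prob}(\mathcal X^G)$. The sequence $(\mu_n)$ locally weak$^\ast$ converges to $\mu$ if for every weak$^\ast$ neighbourhood $\mathcal O$ of $\mu$ the proportion of $v\in V_n$ with $(\Pi^{\sigma_n}_v)_\ast\mu_n\in\mathcal O$ tends to $1$ as $n\to\infty$. It quenched converges to $\mu$ if it locally weak$^\ast$ converges to $\mu$ and in addition $\mu_n(\Omega(\mathcal O,\sigma_n))\to1$ for every weak$^\ast$ neighbourhood $\mathcal O$ of $\mu$. *)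

theory Defs
  imports "HOL-Probability.Probability" "HOL-Combinatorics.Permutations"
begin

text \<open>
  The countable discrete group is a type of sort \<open>{group_add, countable}\<close>; the class
  \<open>group_add\<close> is additively written but not commutative, so the product \<open>gh\<close> is \<open>g + h\<close>
  and the identity is \<open>0\<close>.  The space \<open>\<X>\<close> is a type of class \<open>polish_space\<close> with its
  Borel sets, the metric \<open>d\<close> being \<open>dist\<close> (compactness is required below; a compact metric
  space is always Polish).  The type \<open>'g \<Rightarrow> 'x\<close> carries the product topology, and as \<open>'g\<close> is
  countable its Borel sets are the product sigma-algebra.
\<close>

definition Prob :: "'a::topological_space measure set" where
  "Prob = {M. prob_space M \<and> sets M = sets borel}"

text \<open>
  On a compact space every continuous real function is bounded, so there this is the
  weak-star topology coming from the dual of the continuous functions.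
\<close>

definition weak_star :: "'a::topological_space measure topology" where
  "weak_star = topology_generated_by
     {{M \<in> Prob. (\<integral>x. f x \<partial>M) \<in> U} | (f :: 'a \<Rightarrow> real) U.
        continuous_on UNIV f \<and> bounded (range f) \<and> open U}"

definition proportion :: "'v set \<Rightarrow> ('v \<Rightarrow> bool) \<Rightarrow> real" where
  "proportion V P = real (card {v \<in> V. P v}) / real (card V)"

definition sofic_approximation ::
    "(nat \<Rightarrow> 'v set) \<Rightarrow> (nat \<Rightarrow> 'g::{group_add, countable} \<Rightarrow> 'v \<Rightarrow> 'v) \<Rightarrow> bool" where
  "sofic_approximation V \<sigma> \<longleftrightarrow>
     (\<forall>n\<ge>1. finite (V n) \<and> V n \<noteq> {} \<and> (\<forall>g. \<sigma> n g permutes V n)) \<and>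
     (\<forall>g h. (\<lambda>n. proportion (V n) (\<lambda>v. \<sigma> n g (\<sigma> n h v) = \<sigma> n (g + h) v)) \<longlonglongrightarrow> 1) \<and>
     (\<forall>g. g \<noteq> 0 \<longrightarrow> (\<lambda>n. proportion (V n) (\<lambda>v. \<sigma> n g v \<noteq> v)) \<longlonglongrightarrow> 1)"

definition shift :: "'g::group_add \<Rightarrow> ('g \<Rightarrow> 'x) \<Rightarrow> ('g \<Rightarrow> 'x)" where
  "shift g x = (\<lambda>h. x (h + g))"

definition metric_process ::
    "('g::{group_add, countable} \<Rightarrow> 'x::polish_space) measure \<Rightarrow> bool" where
  "metric_process \<mu> \<longleftrightarrow>
     compact (UNIV :: 'x set) \<and> \<mu> \<in> Prob \<and> (\<forall>g. distr \<mu> borel (shift g) = \<mu>)"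

definition ergodic_process ::
    "('g::{group_add, countable} \<Rightarrow> 'x::polish_space) measure \<Rightarrow> bool" where
  "ergodic_process \<mu> \<longleftrightarrow>
     (\<forall>A \<in> sets borel. (\<forall>g. shift g -` A = A) \<longrightarrow> measure \<mu> A = 0 \<or> measure \<mu> A = 1)"

definition pullback_name :: "('g \<Rightarrow> 'v \<Rightarrow> 'v) \<Rightarrow> 'v \<Rightarrow> ('v \<Rightarrow> 'x) \<Rightarrow> ('g \<Rightarrow> 'x)" where
  "pullback_name \<sigma> v x = (\<lambda>g. x (\<sigma> g v))"

text \<open>\<open>return borel y\<close> is the point mass at \<open>y\<close>.\<close>

definition empirical_distribution ::
    "'v set \<Rightarrow> ('g::countable \<Rightarrow> 'v \<Rightarrow> 'v) \<Rightarrow> ('v \<Rightarrow> 'x::polish_space) \<Rightarrow> ('g \<Rightarrow> 'x) measure" where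
  "empirical_distribution V \<sigma> x =
     measure_of UNIV (sets borel)
       (\<lambda>A. (\<Sum>v\<in>V. emeasure (return borel (pullback_name \<sigma> v x)) A) / of_nat (card V))"

lemma sets_empirical_distribution [simp]:
  "sets (empirical_distribution V \<sigma> x) = sets borel"
  unfolding empirical_distribution_def
  by (metis sets.sigma_sets_eq sets_measure_of space_borel subset_UNIV Pow_UNIV)

text \<open>
  \<open>measure_of\<close> silently gives the null measure unless its argument is countably additive;
  the next lemma rules this out.
\<close>

lemma emeasure_empirical_distribution:
  fixes \<sigma> :: "'g::countable \<Rightarrow> 'v \<Rightarrow> 'v" and x :: "'v \<Rightarrow> 'x::polish_space"
  assumes "A \<in> sets borel"
  shows "emeasure (empirical_distribution V \<sigma> x) A =
    (\<Sum>v\<in>V. emeasure (return borel (pullback_name \<sigma> v x)) A) / of_nat (card V)"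
proof -
  let ?m = "\<lambda>A. (\<Sum>v\<in>V. emeasure (return borel (pullback_name \<sigma> v x)) A) / of_nat (card V)"
  have "countably_additive (sets borel) ?m"
  proof (rule countably_additiveI)
    fix B :: "nat \<Rightarrow> ('g \<Rightarrow> 'x) set"
    assume B: "range B \<subseteq> sets borel" "disjoint_family B" "(\<Union>i. B i) \<in> sets borel"
    have "(\<Sum>i. ?m (B i)) =
        (\<Sum>i. \<Sum>v\<in>V. emeasure (return borel (pullback_name \<sigma> v x)) (B i)) / of_nat (card V)"
      by (simp add: divide_ennreal_def)
    also have "\<dots> =
        (\<Sum>v\<in>V. \<Sum>i. emeasure (return borel (pullback_name \<sigma> v x)) (B i)) / of_nat (card V)"
      by (subst suminf_sum) auto
    also have "\<dots> = ?m (\<Union>i. B i)"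
      using B by (subst suminf_emeasure) auto
    finally show "(\<Sum>i. ?m (B i)) = ?m (\<Union>i. B i)" .
  qed
  then have "countably_additive (sets (empirical_distribution V \<sigma> x)) ?m" by simp
  moreover have "positive (sets (empirical_distribution V \<sigma> x)) ?m"
    by (simp add: positive_def)
  ultimately show ?thesis
    using assms by (intro emeasure_measure_of[OF empirical_distribution_def]) auto
qed

definition good_models ::
    "('g::countable \<Rightarrow> 'x::polish_space) measure set \<Rightarrow> 'v set \<Rightarrow> ('g \<Rightarrow> 'v \<Rightarrow> 'v) \<Rightarrow> ('v \<Rightarrow> 'x) set"
    where
  "good_models W V \<sigma> = {x \<in> V \<rightarrow>\<^sub>E UNIV. empirical_distribution V \<sigma> x \<in> W}"

text \<open>
  Neighbourhoods are taken open, which does not change convergence and makes the sets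
  \<open>good_models W V \<sigma>\<close> measurable.
\<close>

definition locally_weak_star_converges ::
    "(nat \<Rightarrow> 'v set) \<Rightarrow> (nat \<Rightarrow> 'g::countable \<Rightarrow> 'v \<Rightarrow> 'v) \<Rightarrow> (nat \<Rightarrow> ('v \<Rightarrow> 'x::polish_space) measure)
      \<Rightarrow> ('g \<Rightarrow> 'x) measure \<Rightarrow> bool" where
  "locally_weak_star_converges V \<sigma> \<mu>s \<mu> \<longleftrightarrow>
     (\<forall>W. openin weak_star W \<and> \<mu> \<in> W \<longrightarrow>
        (\<lambda>n. proportion (V n) (\<lambda>v. distr (\<mu>s n) borel (pullback_name (\<sigma> n) v) \<in> W)) \<longlonglongrightarrow> 1)"

definition quenched_converges ::
    "(nat \<Rightarrow> 'v set) \<Rightarrow> (nat \<Rightarrow> 'g::countable \<Rightarrow> 'v \<Rightarrow> 'v) \<Rightarrow> (nat \<Rightarrow> ('v \<Rightarrow> 'x::polish_space) measure)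
      \<Rightarrow> ('g \<Rightarrow> 'x) measure \<Rightarrow> bool" where
  "quenched_converges V \<sigma> \<mu>s \<mu> \<longleftrightarrow>
     locally_weak_star_converges V \<sigma> \<mu>s \<mu> \<and>
     (\<forall>W. openin weak_star W \<and> \<mu> \<in> W \<longrightarrow>
        (\<lambda>n. measure (\<mu>s n) (good_models W (V n) (\<sigma> n))) \<longlonglongrightarrow> 1)"

end

theory Submission
  imports Defs
begin

text \<open>
  The idea is to replace the individual empirical measures by averages over translates, where
  ergodicity of \<open>\<mu>\<close> can act.  Write \<open>P\<^sub>x f\<close> for the average of \<open>f\<close> over the pullback names of
  a model \<open>x\<close>; it is the integral of \<open>f\<close> against the empirical distribution of \<open>x\<close>.

  Soficity makes \<open>P\<^sub>x\<close> almost shift invariant, uniformly in \<open>x\<close>: a continuous function on the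
  compact space of names depends up to \<open>\<epsilon>\<close> on finitely many coordinates, and on these coordinates
  translating the name of \<open>v\<close> by \<open>g\<close> gives the name of \<open>\<sigma>\<^sup>g(v)\<close> for all but a vanishing proportion
  of \<open>v\<close>.  Hence \<open>P\<^sub>x F\<close> and \<open>P\<^sub>x f\<close> are close for every dyadic convex combination \<open>F\<close> of
  translates of \<open>f\<close> (\<open>orbit_hull_name_average\<close>).

  A sofic group may fail to be amenable and then has no Folner averages.  The mean ergodic theorem
  of Alaoglu and Birkhoff holds for every group: a minimising sequence for the \<open>L\<^sup>2\<close> norm on the convex hull of
  the translates of \<open>f\<close> converges to an invariant function, which by ergodicity is the constant
  \<open>\<integral>f d\<mu>\<close>.  So \<open>F\<close> can be chosen with \<open>\<integral>\<bar>F - \<integral>f d\<mu>\<bar> d\<mu>\<close> as small as desired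
  (\<open>ergodic_orbit_hull\<close>).

  For this fixed \<open>F\<close>, local convergence bounds the expectation of \<open>P\<^sub>x \<bar>F - \<integral>f d\<mu>\<bar>\<close> over a random
  model \<open>x\<close>, because that expectation is the average over \<open>v\<close> of the integrals against the local
  marginals (\<open>expected_name_average_small\<close>).  By Markov's inequality \<open>P\<^sub>x F\<close>, and with it
  \<open>P\<^sub>x f\<close>, is close to \<open>\<integral>f d\<mu>\<close> with high probability (\<open>name_average_concentrates\<close>).  Finite
  intersections and unions extend this from the sets generating the weak-star topology to all
  weak-star open sets (\<open>good_models_concentrate\<close>).
\<close>

section \<open>Continuous functions on a compact power\<close>

text \<open>
  Every point \<open>z\<close> has a cylinder around it on which \<open>f\<close> stays within \<open>e/2\<close> of \<open>f z\<close>, and the power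
  is compact by Tychonoff's theorem; the coordinates constrained by a finite subcover suffice.  This plays the
  role of uniform continuity without the choice of a metric on the power.
\<close>

lemma continuous_depends_on_finitely_many_coordinates:
  fixes f :: "('i \<Rightarrow> 'a::topological_space) \<Rightarrow> 'b::metric_space"
  assumes comp: "compact (UNIV :: 'a set)" and f: "continuous_on UNIV f" and e: "e > 0"
  obtains K where "finite K" "\<And>x y. (\<And>i. i \<in> K \<Longrightarrow> x i = y i) \<Longrightarrow> dist (f x) (f y) < e"
proof -
  have comp': "compact (UNIV :: ('i \<Rightarrow> 'a) set)"
    using comp compact_space_product_topology[of "\<lambda>_::'i. euclidean :: 'a topology" UNIV]
    by (simp add: euclidean_product_topology compact_space_def)
  have "\<exists>N K. open N \<and> z \<in> N \<and> finite K \<and> N \<subseteq> f -` ball (f z) (e/2) \<and>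
      (\<forall>x y. x \<in> N \<longrightarrow> (\<forall>i\<in>K. x i = y i) \<longrightarrow> y \<in> N)" for z
  proof -
    have "open (f -` ball (f z) (e/2))"
      using f by (simp add: open_vimage)
    then have "openin (product_topology (\<lambda>_. euclidean) UNIV) (f -` ball (f z) (e/2))"
      by (simp add: euclidean_product_topology)
    from product_topology_open_contains_basis[OF this, of z] e
    obtain X where X: "z \<in> Pi\<^sub>E UNIV X" "\<And>i. open (X i)" "finite {i. X i \<noteq> UNIV}"
        "Pi\<^sub>E UNIV X \<subseteq> f -` ball (f z) (e/2)"
      by auto
    have "y \<in> Pi\<^sub>E UNIV X" if "x \<in> Pi\<^sub>E UNIV X" "\<forall>i\<in>{i. X i \<noteq> UNIV}. x i = y i" for x y
    proof -
      have "y i \<in> X i" for i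
      proof (cases "X i = UNIV")
        case False
        then have "x i = y i" using that(2) by simp
        moreover have "x i \<in> X i" using that(1) by (simp add: PiE_iff)
        ultimately show ?thesis by simp
      qed simp
      then show ?thesis by (simp add: PiE_iff)
    qed
    then show ?thesis
      using X open_PiE[OF X(2,3)] by (intro exI[of _ "Pi\<^sub>E UNIV X"] exI[of _ "{i. X i \<noteq> UNIV}"]) blast
  qed
  then obtain N K where NK: "\<And>z. open (N z)" "\<And>z. z \<in> N z" "\<And>z. finite (K z)"
      "\<And>z. N z \<subseteq> f -` ball (f z) (e/2)"
      "\<And>z x y. x \<in> N z \<Longrightarrow> \<forall>i\<in>K z. x i = y i \<Longrightarrow> y \<in> N z"
    by metis
  obtain Z where Z: "finite Z" "(UNIV :: ('i \<Rightarrow> 'a) set) \<subseteq> (\<Union>z\<in>Z. N z)"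
  proof (rule compactE_image[OF comp', of UNIV N])
    show "open (N z)" for z by (rule NK(1))
    show "UNIV \<subseteq> (\<Union>z. N z)" using NK(2) by fast
  qed (rule that)
  show thesis
  proof (rule that)
    show "finite (\<Union>z\<in>Z. K z)" using Z(1) NK(3) by (rule finite_UN_I)
    fix x y :: "'i \<Rightarrow> 'a"
    assume eq: "\<And>i. i \<in> (\<Union>z\<in>Z. K z) \<Longrightarrow> x i = y i"
    obtain z where z: "z \<in> Z" "x \<in> N z" using Z(2) by fast
    have "\<forall>i\<in>K z. x i = y i" using eq z(1) by fast
    with z(2) have "y \<in> N z" by (rule NK(5))
    with z(2) NK(4)[of z] have "dist (f z) (f x) < e/2" "dist (f z) (f y) < e/2" by auto
    then show "dist (f x) (f y) < e" by (metis dist_commute dist_triangle_half_l)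
  qed
qed

section \<open>Convex combinations of translates\<close>

text \<open>
  The dyadic convex combinations of the translates of \<open>f\<close>.  Closure under midpoints is all that
  the parallelogram law asks for, and it lets properties of the hull be proved by
  rule induction, without coefficients or sums.
\<close>

inductive_set orbit_hull :: "(('g::group_add \<Rightarrow> 'x) \<Rightarrow> real) \<Rightarrow> (('g \<Rightarrow> 'x) \<Rightarrow> real) set"
  for f :: "('g \<Rightarrow> 'x) \<Rightarrow> real" where
  translate: "(\<lambda>x. f (shift g x)) \<in> orbit_hull f"
| midpoint: "F \<in> orbit_hull f \<Longrightarrow> H \<in> orbit_hull f \<Longrightarrow> (\<lambda>x. (F x + H x) / 2) \<in> orbit_hull f"

lemma shift_shift: "shift g (shift h x) = shift (g + h) x"
  by (simp add: shift_def add.assoc)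

lemma continuous_shift [continuous_intros]: "continuous_on UNIV (shift g)"
  unfolding shift_def by (intro continuous_intros) auto

lemma measurable_shift [measurable]:
  "shift g \<in> borel \<rightarrow>\<^sub>M (borel :: ('g::{group_add, countable} \<Rightarrow> 'x::polish_space) measure)"
  by (rule borel_measurable_continuous_onI) (rule continuous_shift)

lemma orbit_hull_shift:
  assumes "F \<in> orbit_hull f" shows "(\<lambda>x. F (shift h x)) \<in> orbit_hull f"
  using assms by induction (auto simp: shift_shift intro: orbit_hull.intros)

lemma orbit_hull_continuous:
  assumes "F \<in> orbit_hull f" "continuous_on UNIV f" shows "continuous_on UNIV F"
  using assms(1)
proof induction
  case (translate g)
  show ?case
    using continuous_on_compose2[OF assms(2) continuous_shift] by simp
qed (auto intro: continuous_intros)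

lemma orbit_hull_bounded:
  assumes "F \<in> orbit_hull f" "\<And>x. \<bar>f x\<bar> \<le> B" shows "\<bar>F x\<bar> \<le> B"
  using assms(1)
proof induction
  case (midpoint F H)
  then show ?case by (auto simp: abs_le_iff)
qed (use assms(2) in simp)

section \<open>The mean ergodic theorem\<close>

text \<open>
  The variance of \<open>\<bar>X\<bar>\<close> is nonnegative.
\<close>

lemma expectation_abs_square_le:
  fixes X :: "'a \<Rightarrow> real"
  assumes "prob_space M" "X \<in> borel_measurable M" "\<And>x. \<bar>X x\<bar> \<le> B"
  shows "(\<integral>x. \<bar>X x\<bar> \<partial>M)\<^sup>2 \<le> (\<integral>x. (X x)\<^sup>2 \<partial>M)"
proof -
  interpret prob_space M by fact
  note [measurable] = assms(2)
  have "integrable M (\<lambda>x. \<bar>X x\<bar>)"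
    by (rule integrable_const_bound[of _ B]) (use assms(3) in auto)
  moreover have "integrable M (\<lambda>x. \<bar>X x\<bar>\<^sup>2)"
    by (rule integrable_const_bound[of _ "B\<^sup>2"])
      (use power_mono[OF assms(3) abs_ge_zero, of _ 2] in simp_all)
  ultimately show ?thesis
    using variance_eq[of "\<lambda>x. \<bar>X x\<bar>"] variance_positive[of "\<lambda>x. \<bar>X x\<bar>"] by simp
qed

text \<open>
  A superlevel set of \<open>u\<close> need not be exactly invariant, so it is replaced by the set
  of points whose whole orbit lies in it.  As the group is countable this changes only a null
  set, and the new set is invariant on the nose.  Taking the threshold to be the mean \<open>c\<close> of \<open>u\<close>
  makes a single set enough: it cannot have full measure since then the mean would exceed \<open>c\<close>,
  so \<open>u \<le> c\<close> almost everywhere, and \<open>c - u\<close> is nonnegative with integral zero.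
\<close>

lemma invariant_function_const:
  fixes \<mu> :: "('g::{group_add, countable} \<Rightarrow> 'x::polish_space) measure"
    and u :: "('g \<Rightarrow> 'x) \<Rightarrow> real"
  assumes \<mu>: "\<mu> \<in> Prob" and erg: "ergodic_process \<mu>"
    and u [measurable]: "u \<in> borel_measurable borel" and int: "integrable \<mu> u"
    and inv: "\<And>g. AE x in \<mu>. u (shift g x) = u x"
  shows "AE x in \<mu>. u x = (\<integral>x. u x \<partial>\<mu>)"
proof -
  interpret prob_space \<mu> using \<mu> by (simp add: Prob_def)
  have sets [measurable_cong]: "sets \<mu> = sets borel" using \<mu> by (simp add: Prob_def)
  have space: "space \<mu> = UNIV" using sets_eq_imp_space_eq[OF sets] by simp
  define c where "c = (\<integral>x. u x \<partial>\<mu>)"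
  define A where "A = {x. \<forall>g. u (shift g x) > c}"
  have A [measurable]: "A \<in> sets borel" unfolding A_def by measurable
  have inv_A: "shift h -` A = A" for h
  proof -
    have "(\<forall>g. u (shift (g + h) x) > c) \<longleftrightarrow> (\<forall>g. u (shift g x) > c)" for x
      by (metis add.assoc add.right_neutral right_minus minus_add_cancel diff_add_cancel)
    then show ?thesis by (auto simp: A_def shift_shift)
  qed
  have "AE x in \<mu>. \<forall>g. u (shift g x) = u x"
    using inv by (simp add: AE_all_countable)
  then have AE_A: "AE x in \<mu>. x \<in> A \<longleftrightarrow> u x > c"
    by eventually_elim (auto simp: A_def)
  have "measure \<mu> A = 0 \<or> measure \<mu> A = 1"
    using erg A inv_A by (auto simp: ergodic_process_def)
  moreover have False if "measure \<mu> A = 1"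
  proof -
    have "AE x in \<mu>. x \<in> A" using that A sets by (subst (asm) prob_eq_1) auto
    with AE_A have "AE x in \<mu>. c < u x" by eventually_elim auto
    then have "(\<integral>x. c \<partial>\<mu>) < (\<integral>x. u x \<partial>\<mu>)"
      using int by (intro integral_less_AE_space) (auto simp: emeasure_space_1)
    then show False by (simp add: c_def prob_space)
  qed
  ultimately have "AE x in \<mu>. x \<notin> A" using A sets by (subst (asm) prob_eq_0) auto
  with AE_A have le: "AE x in \<mu>. 0 \<le> c - u x" by eventually_elim auto
  have "(\<integral>x. c - u x \<partial>\<mu>) = 0" using int by (simp add: c_def prob_space)
  then have "AE x in \<mu>. c - u x = 0"
    using integral_nonneg_eq_0_iff_AE[of \<mu> "\<lambda>x. c - u x"] int le by auto
  then show ?thesis unfolding c_def by eventually_elim auto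
qed

lemma orbit_hull_integral:
  fixes \<mu> :: "('g::{group_add, countable} \<Rightarrow> 'x::polish_space) measure"
  assumes \<mu>: "\<mu> \<in> Prob" and inv: "\<And>g. distr \<mu> borel (shift g) = \<mu>"
    and f: "continuous_on UNIV f" "\<And>x. \<bar>f x\<bar> \<le> B" and F: "F \<in> orbit_hull f"
  shows "(\<integral>x. F x \<partial>\<mu>) = (\<integral>x. f x \<partial>\<mu>)"
proof -
  interpret prob_space \<mu> using \<mu> by (simp add: Prob_def)
  have sets [measurable_cong]: "sets \<mu> = sets borel" using \<mu> by (simp add: Prob_def)
  have meas: "F \<in> borel_measurable \<mu>" if "F \<in> orbit_hull f" for F
    using borel_measurable_continuous_onI[OF orbit_hull_continuous[OF that f(1)]]
    by (simp add: measurable_cong_sets[OF sets refl])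
  have int: "integrable \<mu> F" if "F \<in> orbit_hull f" for F
    by (rule integrable_const_bound[of _ B])
      (use that orbit_hull_bounded[OF that f(2)] meas in auto)
  from F show ?thesis
  proof induction
    case (translate g)
    have "(\<integral>x. f x \<partial>distr \<mu> borel (shift g)) = (\<integral>x. f (shift g x) \<partial>\<mu>)"
      using borel_measurable_continuous_onI[OF f(1)] by (intro integral_distr) auto
    then show ?case by (simp add: inv)
  next
    case (midpoint F H)
    then show ?case using int[of F] int[of H] by simp
  qed
qed

text \<open>
  The argument of Alaoglu and Birkhoff.  By the parallelogram law, two elements of the hull whose
  \<open>L\<^sup>2\<close> norms are nearly minimal are close to each other.  This is used twice: a minimising
  sequence is Cauchy, and since translation preserves both the hull and the norm, it is close to
  its own translates, so that the limit is invariant and hence constant.  All functions in the hull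
  share the bound \<open>B\<close>, so after the \<open>L\<^sup>2\<close> estimate everything takes place in \<open>L\<^sup>1\<close>, with almost
  everywhere convergence along a subsequence and dominated convergence.
\<close>

lemma ergodic_orbit_hull:
  fixes \<mu> :: "('g::{group_add, countable} \<Rightarrow> 'x::polish_space) measure"
  assumes \<mu>: "\<mu> \<in> Prob" and inv: "\<And>g. distr \<mu> borel (shift g) = \<mu>"
    and erg: "ergodic_process \<mu>"
    and f: "continuous_on UNIV f" "\<And>x. \<bar>f x\<bar> \<le> B" and e: "e > 0"
  obtains F where "F \<in> orbit_hull f" "(\<integral>x. \<bar>F x - (\<integral>x. f x \<partial>\<mu>)\<bar> \<partial>\<mu>) < e"
proof -
  interpret prob_space \<mu> using \<mu> by (simp add: Prob_def)
  have sets [measurable_cong]: "sets \<mu> = sets borel" using \<mu> by (simp add: Prob_def)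
  define H where "H = orbit_hull f"
  define q :: "(('g \<Rightarrow> 'x) \<Rightarrow> real) \<Rightarrow> real" where "q F = (\<integral>x. (F x)\<^sup>2 \<partial>\<mu>)" for F
  define m where "m = Inf (q ` H)"
  have meas [measurable]: "F \<in> borel_measurable borel" if "F \<in> H" for F
    using orbit_hull_continuous[OF _ f(1)] that
    unfolding H_def by (intro borel_measurable_continuous_onI)
  have bnd: "\<bar>F x\<bar> \<le> B" if "F \<in> H" for F x
    using that f(2) unfolding H_def by (rule orbit_hull_bounded)
  have int1: "integrable \<mu> F" if F: "F \<in> H" for F
    by (rule integrable_const_bound[of _ B]) (use F bnd in auto)
  have int2: "integrable \<mu> (\<lambda>x. F x * G x)" if F: "F \<in> H" and G: "G \<in> H" for F G
  proof (rule integrable_const_bound[of _ "B * B"])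
    show "AE x in \<mu>. norm (F x * G x) \<le> B * B"
    proof (rule AE_I2)
      fix x
      have "0 \<le> B" using bnd[OF F, of x] by linarith
      then show "norm (F x * G x) \<le> B * B"
        using mult_mono[OF bnd[OF F, of x] bnd[OF G, of x]] by (simp add: abs_mult)
    qed
    show "(\<lambda>x. F x * G x) \<in> borel_measurable \<mu>" using F G by measurable
  qed
  have mid: "(\<lambda>x. (F x + G x) / 2) \<in> H" if "F \<in> H" "G \<in> H" for F G
    using that unfolding H_def by (rule orbit_hull.midpoint)
  have m_le: "m \<le> q F" if "F \<in> H" for F
    unfolding m_def using that by (intro cInf_lower) (auto intro!: bdd_belowI[of _ 0] simp: q_def)
  have Hne: "H \<noteq> {}" using orbit_hull.translate[of f] by (auto simp: H_def)
  have "\<exists>F\<in>H. q F < m + 1 / real (Suc n)" for n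
    using cInf_lessD[of "q ` H" "m + 1 / real (Suc n)"] Hne unfolding m_def by auto
  then obtain F where F: "\<And>n. F n \<in> H" "\<And>n. q (F n) < m + 1 / real (Suc n)"
    by metis
  have q_shift: "q (\<lambda>x. G (shift g x)) = q G" if [simp]: "G \<in> H" for G g
  proof -
    have "(\<integral>x. (G x)\<^sup>2 \<partial>distr \<mu> borel (shift g)) = (\<integral>x. (G (shift g x))\<^sup>2 \<partial>\<mu>)"
      by (intro integral_distr) auto
    then show ?thesis by (simp add: inv q_def)
  qed
  \<comment> \<open>The midpoint of \<open>G\<close> and \<open>G'\<close> lies in the hull, so its square integral is at least \<open>m\<close>;
    the parallelogram law then leaves less than \<open>4 * d\<close> for the distance.\<close>
  have close: "(\<integral>x. \<bar>G x - G' x\<bar> \<partial>\<mu>) < a"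
    if G: "G \<in> H" and G': "G' \<in> H" and q: "q G < m + d" "q G' < m + d" "4 * d \<le> a\<^sup>2" "a > 0"
    for G G' a d
  proof -
    have "(\<integral>x. (G x - G' x)\<^sup>2 \<partial>\<mu>) = 2 * q G + 2 * q G' - 4 * q (\<lambda>x. (G x + G' x) / 2)"
    proof -
      have "2 * q G + 2 * q G' - 4 * q (\<lambda>x. (G x + G' x) / 2)
          = (\<integral>x. 2 * (G x)\<^sup>2 + 2 * (G' x)\<^sup>2 - 4 * ((G x + G' x) / 2)\<^sup>2 \<partial>\<mu>)"
      proof -
        have lin: "2 * (\<integral>x. a x \<partial>\<mu>) + 2 * (\<integral>x. b x \<partial>\<mu>) - 4 * (\<integral>x. c x \<partial>\<mu>)
            = (\<integral>x. 2 * a x + 2 * b x - 4 * c x \<partial>\<mu>)"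
          if "integrable \<mu> a" "integrable \<mu> b" "integrable \<mu> c" for a b c :: "('g \<Rightarrow> 'x) \<Rightarrow> real"
          using that by simp
        show ?thesis
          unfolding q_def power2_eq_square
          by (rule lin[OF int2[OF G G] int2[OF G' G'] int2[OF mid[OF G G'] mid[OF G G']]])
      qed
      also have "\<dots> = (\<integral>x. (G x - G' x)\<^sup>2 \<partial>\<mu>)"
        by (rule Bochner_Integration.integral_cong) (auto simp: power2_eq_square field_simps)
      finally show ?thesis ..
    qed
    also have "\<dots> < 4 * d" using q m_le[OF mid[OF G G']] by linarith
    also have "\<dots> \<le> a\<^sup>2" by fact
    finally have *: "(\<integral>x. (G x - G' x)\<^sup>2 \<partial>\<mu>) < a\<^sup>2" .
    have "(\<integral>x. \<bar>G x - G' x\<bar> \<partial>\<mu>)\<^sup>2 \<le> (\<integral>x. (G x - G' x)\<^sup>2 \<partial>\<mu>)"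
    proof (rule expectation_abs_square_le[where B = "B + B"])
      show "\<bar>G x - G' x\<bar> \<le> B + B" for x using bnd[OF G, of x] bnd[OF G', of x] by linarith
    qed (use G G' in \<open>auto intro: prob_space_axioms\<close>)
    with * have "(\<integral>x. \<bar>G x - G' x\<bar> \<partial>\<mu>)\<^sup>2 < a\<^sup>2" by simp
    then show ?thesis by (rule power2_less_imp_less) (use q in auto)
  qed
  have small: "\<exists>N. \<forall>i\<ge>N. 4 * (1 / real (Suc i)) \<le> a\<^sup>2" if "a > 0" for a :: real
  proof -
    have "(\<lambda>i. 4 * (1 / real (Suc i))) \<longlonglongrightarrow> 4 * 0"
      by (intro tendsto_intros LIMSEQ_inverse_real_of_nat[unfolded inverse_eq_divide])
    then have "\<forall>\<^sub>F i in sequentially. 4 * (1 / real (Suc i)) < a\<^sup>2"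
      using that by (intro order_tendstoD) auto
    then show ?thesis unfolding eventually_sequentially by (meson less_imp_le)
  qed
  have cauchy: "\<exists>N. \<forall>i\<ge>N. \<forall>j\<ge>N. (\<integral>x. norm (F i x - F j x) \<partial>\<mu>) < a" if "a > 0" for a
  proof -
    obtain N where N: "\<forall>i\<ge>N. 4 * (1 / real (Suc i)) \<le> a\<^sup>2" using small[OF \<open>a > 0\<close>] by auto
    have "(\<integral>x. norm (F i x - F j x) \<partial>\<mu>) < a" if "i \<ge> N" "j \<ge> N" for i j
    proof -
      have "1 / real (Suc i) \<le> 1 / real (Suc N)" "1 / real (Suc j) \<le> 1 / real (Suc N)"
        using that by (auto simp: field_simps)
      then show ?thesis
        using close[OF F(1) F(1), of i "1 / real (Suc N)" j a] F(2)[of i] F(2)[of j] N \<open>a > 0\<close>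
        by auto
    qed
    then show ?thesis by auto
  qed
  obtain r where r: "strict_mono r" "AE x in \<mu>. Cauchy (\<lambda>i. F (r i) x)"
    using cauchy_L1_AE_cauchy_subseq[of \<mu> F] cauchy int1[OF F(1)] by auto
  define u where "u x = lim (\<lambda>i. F (r i) x)" for x
  have F_meas [measurable]: "F i \<in> borel_measurable borel" for i using F(1) by auto
  have u_meas [measurable]: "u \<in> borel_measurable borel" unfolding u_def by measurable
  have lim: "AE x in \<mu>. (\<lambda>i. F (r i) x) \<longlonglongrightarrow> u x"
    using r(2) by eventually_elim (auto simp: u_def Cauchy_convergent_iff convergent_LIMSEQ_iff)
  have L: "integrable \<mu> u" "(\<lambda>i. \<integral>x. F (r i) x \<partial>\<mu>) \<longlonglongrightarrow> (\<integral>x. u x \<partial>\<mu>)"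
  proof -
    have bound: "AE x in \<mu>. norm (F (r i) x) \<le> B" for i using bnd[OF F(1)] by simp
    show "integrable \<mu> u" by (rule integrable_dominated_convergence[OF _ _ _ lim bound]) simp_all
    show "(\<lambda>i. \<integral>x. F (r i) x \<partial>\<mu>) \<longlonglongrightarrow> (\<integral>x. u x \<partial>\<mu>)"
      by (rule integral_dominated_convergence[OF _ _ _ lim bound]) simp_all
  qed
  have "(\<integral>x. F (r i) x \<partial>\<mu>) = (\<integral>x. f x \<partial>\<mu>)" for i
    using orbit_hull_integral[OF \<mu> inv f] F(1) by (auto simp: H_def)
  with L have u_int: "(\<integral>x. u x \<partial>\<mu>) = (\<integral>x. f x \<partial>\<mu>)"
    by (simp add: LIMSEQ_const_iff)
  have "AE x in \<mu>. u (shift g x) = u x" for g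
  proof -
    have lim_g: "AE x in \<mu>. (\<lambda>i. F (r i) (shift g x)) \<longlonglongrightarrow> u (shift g x)"
    proof -
      have "AE x in distr \<mu> borel (shift g). (\<lambda>i. F (r i) x) \<longlonglongrightarrow> u x"
        by (subst inv) (rule lim)
      then show ?thesis by (rule AE_distrD[rotated]) measurable
    qed
    have lim0: "(\<lambda>i. \<integral>x. \<bar>F (r i) (shift g x) - F (r i) x\<bar> \<partial>\<mu>) \<longlonglongrightarrow> 0"
    proof (rule LIMSEQ_I)
      fix a :: real assume a: "a > 0"
      obtain N where N: "\<forall>i\<ge>N. 4 * (1 / real (Suc i)) \<le> a\<^sup>2" using small[OF a] by auto
      have "(\<integral>x. \<bar>F (r i) (shift g x) - F (r i) x\<bar> \<partial>\<mu>) < a" if "i \<ge> N" for i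
      proof (rule close[of _ _ "1 / real (Suc (r i))"])
        show "(\<lambda>x. F (r i) (shift g x)) \<in> H" using F(1) by (auto simp: H_def orbit_hull_shift)
        show "4 * (1 / real (Suc (r i))) \<le> a\<^sup>2"
          using N seq_suble[OF r(1), of i] that by auto
      qed (use F a q_shift in auto)
      then show "\<exists>N. \<forall>i\<ge>N. norm ((\<integral>x. \<bar>F (r i) (shift g x) - F (r i) x\<bar> \<partial>\<mu>) - 0) < a"
        by (auto simp: abs_of_nonneg[OF integral_nonneg_AE])
    qed
    have "integrable \<mu> (\<lambda>x. \<bar>u (shift g x) - u x\<bar>)"
      and lim1: "(\<lambda>i. \<integral>x. \<bar>F (r i) (shift g x) - F (r i) x\<bar> \<partial>\<mu>) \<longlonglongrightarrow> (\<integral>x. \<bar>u (shift g x) - u x\<bar> \<partial>\<mu>)"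
    proof -
      have conv: "AE x in \<mu>. (\<lambda>i. \<bar>F (r i) (shift g x) - F (r i) x\<bar>) \<longlonglongrightarrow> \<bar>u (shift g x) - u x\<bar>"
        using lim lim_g by eventually_elim (auto intro!: tendsto_intros)
      have bound: "AE x in \<mu>. norm \<bar>F (r i) (shift g x) - F (r i) x\<bar> \<le> B + B" for i
      proof (rule AE_I2)
        fix x
        show "norm \<bar>F (r i) (shift g x) - F (r i) x\<bar> \<le> B + B"
          using bnd[OF F(1), of "r i" x] bnd[OF F(1), of "r i" "shift g x"]
          unfolding real_norm_def by linarith
      qed
      show "integrable \<mu> (\<lambda>x. \<bar>u (shift g x) - u x\<bar>)"
        by (rule integrable_dominated_convergence[OF _ _ _ conv bound]) auto
      show "(\<lambda>i. \<integral>x. \<bar>F (r i) (shift g x) - F (r i) x\<bar> \<partial>\<mu>) \<longlonglongrightarrow> (\<integral>x. \<bar>u (shift g x) - u x\<bar> \<partial>\<mu>)"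
        by (rule integral_dominated_convergence[OF _ _ _ conv bound]) auto
    qed
    moreover have "(\<integral>x. \<bar>u (shift g x) - u x\<bar> \<partial>\<mu>) = 0"
      using LIMSEQ_unique[OF lim1 lim0] .
    ultimately have "AE x in \<mu>. \<bar>u (shift g x) - u x\<bar> = 0"
      by (subst (asm) integral_nonneg_eq_0_iff_AE) auto
    then show ?thesis by eventually_elim auto
  qed
  from invariant_function_const[OF \<mu> erg u_meas L(1) this]
  have u_const: "AE x in \<mu>. u x = (\<integral>x. f x \<partial>\<mu>)" by (simp add: u_int)
  define c where "c = (\<integral>x. f x \<partial>\<mu>)"
  have "(\<lambda>i. \<integral>x. \<bar>F (r i) x - c\<bar> \<partial>\<mu>) \<longlonglongrightarrow> (\<integral>x. 0 \<partial>\<mu>)"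
  proof (rule integral_dominated_convergence[where w = "\<lambda>_. B + \<bar>c\<bar>"])
    show "AE x in \<mu>. (\<lambda>i. \<bar>F (r i) x - c\<bar>) \<longlonglongrightarrow> 0"
      using lim u_const
    proof eventually_elim
      case (elim x)
      then have "(\<lambda>i. F (r i) x) \<longlonglongrightarrow> c" by (simp add: c_def)
      then show ?case by (simp add: LIM_zero tendsto_rabs_zero)
    qed
    show "AE x in \<mu>. norm \<bar>F (r i) x - c\<bar> \<le> B + \<bar>c\<bar>" for i
    proof (rule AE_I2)
      fix x
      show "norm \<bar>F (r i) x - c\<bar> \<le> B + \<bar>c\<bar>"
        using bnd[OF F(1), of "r i" x] unfolding real_norm_def by linarith
    qed
  qed auto
  then have "\<forall>\<^sub>F i in sequentially. (\<integral>x. \<bar>F (r i) x - c\<bar> \<partial>\<mu>) < e"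
    using e by (intro order_tendstoD) auto
  then obtain i where "(\<integral>x. \<bar>F (r i) x - c\<bar> \<partial>\<mu>) < e"
    by (auto simp: eventually_sequentially)
  with F(1) show thesis by (intro that[of "F (r i)"]) (auto simp: H_def c_def)
qed

section \<open>Averages over the names of a model\<close>

definition name_average ::
    "'v set \<Rightarrow> ('g \<Rightarrow> 'v \<Rightarrow> 'v) \<Rightarrow> (('g \<Rightarrow> 'x) \<Rightarrow> real) \<Rightarrow> ('v \<Rightarrow> 'x) \<Rightarrow> real" where
  "name_average V \<sigma> f x = (\<Sum>v\<in>V. f (pullback_name \<sigma> v x)) / real (card V)"

text \<open>
  Turns the defining sum of point masses into an image measure, to which the general facts about
  \<open>distr\<close> apply.
\<close>

lemma empirical_distribution_eq_distr:
  fixes \<sigma> :: "'g::countable \<Rightarrow> 'v \<Rightarrow> 'v" and x :: "'v \<Rightarrow> 'x::polish_space"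
  assumes V: "finite V" "V \<noteq> {}"
  shows "empirical_distribution V \<sigma> x =
    distr (uniform_count_measure V) borel (\<lambda>v. pullback_name \<sigma> v x)"
proof (rule measure_eqI)
  fix A assume "A \<in> sets (empirical_distribution V \<sigma> x)"
  then have A: "A \<in> sets borel" by simp
  let ?C = "{v \<in> V. pullback_name \<sigma> v x \<in> A}"
  have C: "(\<lambda>v. pullback_name \<sigma> v x) -` A \<inter> V = ?C" by auto
  have "(\<Sum>v\<in>V. emeasure (return borel (pullback_name \<sigma> v x)) A)
      = (\<Sum>v\<in>V. if v \<in> ?C then 1 else 0)"
    using A by (intro sum.cong) (auto simp: indicator_def)
  also have "\<dots> = of_nat (card ?C)"
    using V by (subst sum.If_cases) (auto simp: Int_def)
  finally have "emeasure (empirical_distribution V \<sigma> x) A = of_nat (card ?C) / of_nat (card V)"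
    by (simp add: emeasure_empirical_distribution[OF A])
  also have "\<dots> = ennreal (real (card ?C) / real (card V))"
    using V by (simp add: divide_ennreal[symmetric] ennreal_of_nat_eq_real_of_nat card_gt_0_iff)
  also have "\<dots> = emeasure (distr (uniform_count_measure V) borel (\<lambda>v. pullback_name \<sigma> v x)) A"
    using A V by (subst emeasure_distr) (auto simp: emeasure_uniform_count_measure space_uniform_count_measure C)
  finally show "emeasure (empirical_distribution V \<sigma> x) A =
      emeasure (distr (uniform_count_measure V) borel (\<lambda>v. pullback_name \<sigma> v x)) A" .
qed simp

lemma empirical_distribution_in_Prob:
  assumes "finite V" "V \<noteq> {}"
  shows "empirical_distribution V \<sigma> x \<in> Prob"
proof -
  interpret prob_space "uniform_count_measure V"
    using assms by (rule prob_space_uniform_count_measure)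
  show ?thesis
    using assms by (simp add: empirical_distribution_eq_distr Prob_def prob_space_distr)
qed

lemma integral_empirical_distribution:
  fixes f :: "('g::countable \<Rightarrow> 'x::polish_space) \<Rightarrow> real"
  assumes "finite V" "V \<noteq> {}" "f \<in> borel_measurable borel"
  shows "(\<integral>y. f y \<partial>empirical_distribution V \<sigma> x) = name_average V \<sigma> f x"
  using assms
  by (simp add: empirical_distribution_eq_distr integral_distr integral_uniform_count_measure
      name_average_def)

lemma proportion_not:
  assumes "finite V" "V \<noteq> {}"
  shows "proportion V (\<lambda>v. \<not> P v) = 1 - proportion V P"
proof -
  have "card {v \<in> V. P v} + card {v \<in> V. \<not> P v} = card ({v \<in> V. P v} \<union> {v \<in> V. \<not> P v})"
    using assms by (intro card_Un_disjoint[symmetric]) auto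
  also have "{v \<in> V. P v} \<union> {v \<in> V. \<not> P v} = V" by auto
  finally have "real (card {v \<in> V. \<not> P v}) = real (card V) - real (card {v \<in> V. P v})"
    by linarith
  moreover have "card V > 0" using assms by (simp add: card_gt_0_iff)
  ultimately show ?thesis by (simp add: proportion_def diff_divide_distrib)
qed

lemma proportion_bex_le:
  assumes "finite K"
  shows "proportion V (\<lambda>v. \<exists>k\<in>K. P k v) \<le> (\<Sum>k\<in>K. proportion V (P k))"
proof -
  have "card {v \<in> V. \<exists>k\<in>K. P k v} = card (\<Union>k\<in>K. {v \<in> V. P k v})"
    by (rule arg_cong[where f = card]) auto
  also have "\<dots> \<le> (\<Sum>k\<in>K. card {v \<in> V. P k v})" using assms by (rule card_UN_le)
  finally have "real (card {v \<in> V. \<exists>k\<in>K. P k v}) \<le> (\<Sum>k\<in>K. real (card {v \<in> V. P k v}))"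
    by (simp only: of_nat_sum[symmetric] of_nat_le_iff)
  then show ?thesis
    unfolding proportion_def sum_divide_distrib[symmetric] by (intro divide_right_mono) auto
qed

text \<open>
  Used with \<open>P\<close> the exceptional vertices, whose proportion tends to zero: they contribute at most
  the crude bound \<open>C\<close>, all others the small bound \<open>e\<close>.
\<close>

lemma average_le:
  fixes a :: "'v \<Rightarrow> real"
  assumes V: "finite V" "V \<noteq> {}"
    and good: "\<And>v. v \<in> V \<Longrightarrow> \<not> P v \<Longrightarrow> a v \<le> e" and bad: "\<And>v. v \<in> V \<Longrightarrow> a v \<le> C"
    and nonneg: "0 \<le> e"
  shows "(\<Sum>v\<in>V. a v) / real (card V) \<le> e + C * proportion V P"
proof -
  have "(\<Sum>v\<in>V. a v) \<le> (\<Sum>v\<in>V. e + (if v \<in> {v \<in> V. P v} then C else 0))"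
    using good bad nonneg by (intro sum_mono) (auto intro: order_trans[OF bad])
  also have "\<dots> = real (card V) * e + C * real (card {v \<in> V. P v})"
    using V by (subst sum.distrib, subst sum.If_cases) (auto simp: Int_def mult.commute)
  finally have "(\<Sum>v\<in>V. a v) / real (card V) \<le>
      (real (card V) * e + C * real (card {v \<in> V. P v})) / real (card V)"
    by (intro divide_right_mono) auto
  also have "\<dots> = e + C * proportion V P"
    using V by (simp add: proportion_def add_divide_distrib)
  finally show ?thesis .
qed

section \<open>Approximate invariance of the empirical averages\<close>

text \<open>
  As \<open>\<sigma> g\<close> is a permutation, the average of \<open>f\<close> over the names of \<open>v\<close> equals its average over the
  names of \<open>\<sigma> g v\<close>.  The latter name agrees on \<open>K\<close> with the translate of the former by \<open>g\<close>
  whenever \<open>\<sigma>\<close> is multiplicative at \<open>v\<close> for the pairs \<open>(h, g)\<close> with \<open>h\<close> in \<open>K\<close>.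
\<close>

lemma name_average_translate:
  fixes \<sigma> :: "'g::group_add \<Rightarrow> 'v \<Rightarrow> 'v"
  assumes V: "finite V" "V \<noteq> {}" and perm: "\<sigma> g permutes V"
    and B: "\<And>x. \<bar>f x\<bar> \<le> B"
    and K: "\<And>x y. (\<And>h. h \<in> K \<Longrightarrow> x h = y h) \<Longrightarrow> \<bar>f x - f y\<bar> \<le> e" and e: "0 \<le> e"
  shows "\<bar>name_average V \<sigma> (\<lambda>x. f (shift g x)) x - name_average V \<sigma> f x\<bar>
    \<le> e + 2 * B * proportion V (\<lambda>v. \<exists>h\<in>K. \<sigma> h (\<sigma> g v) \<noteq> \<sigma> (h + g) v)"
proof -
  let ?d = "\<lambda>v. f (shift g (pullback_name \<sigma> v x)) - f (pullback_name \<sigma> (\<sigma> g v) x)"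
  have "(\<Sum>v\<in>V. f (pullback_name \<sigma> v x)) = (\<Sum>v\<in>V. f (pullback_name \<sigma> (\<sigma> g v) x))"
    by (subst sum.permute[OF perm]) (simp add: comp_def)
  then have "\<bar>name_average V \<sigma> (\<lambda>x. f (shift g x)) x - name_average V \<sigma> f x\<bar>
      = \<bar>\<Sum>v\<in>V. ?d v\<bar> / real (card V)"
    by (simp add: name_average_def sum_subtractf diff_divide_distrib[symmetric])
  also have "\<dots> \<le> (\<Sum>v\<in>V. \<bar>?d v\<bar>) / real (card V)"
    by (intro divide_right_mono sum_abs) auto
  also have "\<dots> \<le> e + 2 * B * proportion V (\<lambda>v. \<exists>h\<in>K. \<sigma> h (\<sigma> g v) \<noteq> \<sigma> (h + g) v)"
  proof (rule average_le[OF V])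
    fix v assume "\<not> (\<exists>h\<in>K. \<sigma> h (\<sigma> g v) \<noteq> \<sigma> (h + g) v)"
    then show "\<bar>?d v\<bar> \<le> e" by (intro K) (auto simp: shift_def pullback_name_def)
  next
    fix v
    show "\<bar>?d v\<bar> \<le> 2 * B"
      using B[of "shift g (pullback_name \<sigma> v x)"] B[of "pullback_name \<sigma> (\<sigma> g v) x"] by linarith
  qed (rule e)
  finally show ?thesis .
qed

lemma sofic_approximation_finite:
  assumes "sofic_approximation V \<sigma>" "n \<ge> 1"
  shows "finite (V n)" "V n \<noteq> {}" "\<sigma> n g permutes V n"
  using assms by (auto simp: sofic_approximation_def)

lemma sofic_translation_defect:
  assumes sofic: "sofic_approximation V \<sigma>" and K: "finite K"
  shows "(\<lambda>n. proportion (V n) (\<lambda>v. \<exists>h\<in>K. \<sigma> n h (\<sigma> n g v) \<noteq> \<sigma> n (h + g) v)) \<longlonglongrightarrow> 0"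
proof (rule tendsto_sandwich[OF _ _ tendsto_const])
  let ?p = "\<lambda>h n. proportion (V n) (\<lambda>v. \<sigma> n h (\<sigma> n g v) = \<sigma> n (h + g) v)"
  have "(\<lambda>n. \<Sum>h\<in>K. 1 - ?p h n) \<longlonglongrightarrow> (\<Sum>h\<in>K. 1 - 1)"
    using sofic by (intro tendsto_intros) (simp add: sofic_approximation_def)
  then show "(\<lambda>n. \<Sum>h\<in>K. 1 - ?p h n) \<longlonglongrightarrow> 0" by simp
  show "\<forall>\<^sub>F n in sequentially.
      proportion (V n) (\<lambda>v. \<exists>h\<in>K. \<sigma> n h (\<sigma> n g v) \<noteq> \<sigma> n (h + g) v) \<le> (\<Sum>h\<in>K. 1 - ?p h n)"
    using eventually_ge_at_top[of 1]
  proof eventually_elim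
    case (elim n)
    show ?case
      using proportion_bex_le[OF K, of "V n" "\<lambda>h v. \<sigma> n h (\<sigma> n g v) \<noteq> \<sigma> n (h + g) v"]
      by (simp add: proportion_not[OF sofic_approximation_finite(1,2)[OF sofic elim]])
  qed
qed (simp add: proportion_def)

text \<open>
  The uniformity in \<open>x\<close> is essential: the set of exceptional vertices does not depend on the
  model, so the estimate may later be applied to a random one.
\<close>

lemma orbit_hull_name_average:
  fixes f :: "('g::{group_add, countable} \<Rightarrow> 'x::polish_space) \<Rightarrow> real"
  assumes sofic: "sofic_approximation V \<sigma>" and comp: "compact (UNIV :: 'x set)"
    and f: "continuous_on UNIV f" and B: "\<And>x. \<bar>f x\<bar> \<le> B"
    and F: "F \<in> orbit_hull f" and e: "e > 0"
  shows "\<forall>\<^sub>F n in sequentially. \<forall>x.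
    \<bar>name_average (V n) (\<sigma> n) F x - name_average (V n) (\<sigma> n) f x\<bar> < e"
  using F
proof induction
  case (translate g)
  obtain K where K: "finite K" "\<And>x y. (\<And>i. i \<in> K \<Longrightarrow> x i = y i) \<Longrightarrow> dist (f x) (f y) < e/2"
    using continuous_depends_on_finitely_many_coordinates[OF comp f, of "e/2"] e by auto
  have K': "\<bar>f x - f y\<bar> \<le> e/2" if "\<And>h. h \<in> K \<Longrightarrow> x h = y h" for x y
    using K(2)[of x y] that by (simp add: dist_real_def)
  let ?p = "\<lambda>n. proportion (V n) (\<lambda>v. \<exists>h\<in>K. \<sigma> n h (\<sigma> n g v) \<noteq> \<sigma> n (h + g) v)"
  have "(\<lambda>n. e/2 + 2 * B * ?p n) \<longlonglongrightarrow> e/2 + 2 * B * 0"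
    by (intro tendsto_intros sofic_translation_defect[OF sofic K(1)])
  then have "\<forall>\<^sub>F n in sequentially. e/2 + 2 * B * ?p n < e"
    by (rule order_tendstoD(2)) (use e in simp)
  then show ?case
    using eventually_ge_at_top[of 1]
  proof eventually_elim
    case (elim n)
    note V = sofic_approximation_finite[OF sofic elim(2)]
    have "\<bar>name_average (V n) (\<sigma> n) (\<lambda>x. f (shift g x)) x - name_average (V n) (\<sigma> n) f x\<bar>
        \<le> e/2 + 2 * B * ?p n" for x
      by (rule name_average_translate[where K = K and B = B]) (use V B K' e in simp_all)
    with elim(1) show ?case by (meson le_less_trans)
  qed
next
  case (midpoint F H)
  from midpoint.IH show ?case
  proof eventually_elim
    case (elim n)
    have avg: "name_average (V n) (\<sigma> n) (\<lambda>x. (F x + H x) / 2) x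
        = (name_average (V n) (\<sigma> n) F x + name_average (V n) (\<sigma> n) H x) / 2" for x
      by (simp add: name_average_def sum.distrib add_divide_distrib flip: sum_divide_distrib)
    have mid: "\<bar>(a + b) / 2 - c\<bar> < e" if "\<bar>a - c\<bar> < e" "\<bar>b - c\<bar> < e" for a b c :: real
      using that unfolding abs_less_iff by (auto simp: field_simps)
    show ?case
      unfolding avg using elim by (intro allI mid) auto
  qed
qed

section \<open>Local convergence and expectations\<close>

lemma measurable_pullback_name:
  fixes \<sigma> :: "'g::countable \<Rightarrow> 'v \<Rightarrow> 'v"
  assumes "\<And>g. \<sigma> g permutes V" "v \<in> V"
  shows "pullback_name \<sigma> v \<in> Pi\<^sub>M V (\<lambda>_. borel) \<rightarrow>\<^sub>M (borel :: ('g \<Rightarrow> 'x::polish_space) measure)"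
  unfolding pullback_name_def using assms
  by (intro measurable_coordinatewise_then_product measurable_component_singleton)
    (simp add: permutes_in_image)

lemma openin_weak_star_basic:
  fixes f :: "'a::topological_space \<Rightarrow> real"
  assumes "continuous_on UNIV f" "bounded (range f)" "open U"
  shows "openin weak_star {M \<in> Prob. (\<integral>x. f x \<partial>M) \<in> U}"
  unfolding weak_star_def using assms by (intro topology_generated_by_Basis) auto

text \<open>
  The measures with \<open>\<integral>h < e\<close> form a weak-star neighbourhood of \<open>\<mu>\<close>, so the marginals at
  all but a vanishing proportion of vertices lie in it; the remaining vertices contribute at most \<open>C\<close> times their proportion.
\<close>

lemma expected_name_average_small:
  fixes h :: "('g::{group_add, countable} \<Rightarrow> 'x::polish_space) \<Rightarrow> real"
  assumes sofic: "sofic_approximation V \<sigma>" and \<mu>: "\<mu> \<in> Prob"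
    and \<mu>s: "\<And>n. n \<ge> 1 \<Longrightarrow> prob_space (\<mu>s n) \<and> sets (\<mu>s n) = sets (Pi\<^sub>M (V n) (\<lambda>_. borel))"
    and local: "locally_weak_star_converges V \<sigma> \<mu>s \<mu>"
    and h: "continuous_on UNIV h" "\<And>x. \<bar>h x\<bar> \<le> C"
    and small: "(\<integral>x. h x \<partial>\<mu>) < e" and e: "0 < e"
  shows "\<forall>\<^sub>F n in sequentially. (\<integral>x. name_average (V n) (\<sigma> n) h x \<partial>\<mu>s n) < 2 * e"
proof -
  define W where "W = {M \<in> Prob. (\<integral>x. h x \<partial>M) \<in> {..<e}}"
  let ?P = "\<lambda>n v. distr (\<mu>s n) borel (pullback_name (\<sigma> n) v) \<in> W"
  have h_meas [measurable]: "h \<in> borel_measurable borel"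
    using h(1) by (rule borel_measurable_continuous_onI)
  have "bounded (range h)" using h(2) by (auto simp: bounded_iff)
  then have "openin weak_star W"
    unfolding W_def using h by (intro openin_weak_star_basic) auto
  moreover have "\<mu> \<in> W" using \<mu> small by (simp add: W_def)
  ultimately have "(\<lambda>n. proportion (V n) (?P n)) \<longlonglongrightarrow> 1"
    using local by (simp add: locally_weak_star_converges_def)
  then have "(\<lambda>n. e + C * (1 - proportion (V n) (?P n))) \<longlonglongrightarrow> e + C * (1 - 1)"
    by (intro tendsto_intros)
  then have "\<forall>\<^sub>F n in sequentially. e + C * (1 - proportion (V n) (?P n)) < 2 * e"
    by (rule order_tendstoD(2)) (use e in simp)
  then show ?thesis
    using eventually_ge_at_top[of 1]
  proof eventually_elim
    case (elim n)
    note V = sofic_approximation_finite[OF sofic elim(2)]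
    interpret prob_space "\<mu>s n" using \<mu>s elim(2) by auto
    have sets: "sets (\<mu>s n) = sets (Pi\<^sub>M (V n) (\<lambda>_. borel))" using \<mu>s elim(2) by auto
    have name [measurable]: "pullback_name (\<sigma> n) v \<in> \<mu>s n \<rightarrow>\<^sub>M borel" if "v \<in> V n" for v
      using measurable_pullback_name[of "\<sigma> n", OF V(3) that]
      by (simp add: measurable_cong_sets[OF sets refl])
    have int: "integrable (\<mu>s n) (\<lambda>x. h (pullback_name (\<sigma> n) v x))" if [measurable]: "v \<in> V n" for v
      by (rule integrable_const_bound[of _ C]) (use h(2) name[OF that] in auto)
    have "(\<integral>x. name_average (V n) (\<sigma> n) h x \<partial>\<mu>s n)
        = (\<Sum>v\<in>V n. \<integral>x. h (pullback_name (\<sigma> n) v x) \<partial>\<mu>s n) / real (card (V n))"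
      using int by (simp add: name_average_def)
    also have "\<dots> \<le> e + C * proportion (V n) (\<lambda>v. \<not> ?P n v)"
    proof (rule average_le[OF V(1,2)])
      fix v assume v: "v \<in> V n" "\<not> \<not> ?P n v"
      have "(\<integral>x. h (pullback_name (\<sigma> n) v x) \<partial>\<mu>s n)
          = (\<integral>x. h x \<partial>distr (\<mu>s n) borel (pullback_name (\<sigma> n) v))"
        using name[OF v(1)] by (intro integral_distr[symmetric]) auto
      also have "\<dots> < e" using v(2) by (simp add: W_def)
      finally show "(\<integral>x. h (pullback_name (\<sigma> n) v x) \<partial>\<mu>s n) \<le> e" by simp
    next
      fix v assume v: "v \<in> V n"
      have "(\<integral>x. h (pullback_name (\<sigma> n) v x) \<partial>\<mu>s n) \<le> (\<integral>x. C \<partial>\<mu>s n)"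
        using int[OF v] h(2) by (intro integral_mono) (auto simp: abs_le_iff)
      then show "(\<integral>x. h (pullback_name (\<sigma> n) v x) \<partial>\<mu>s n) \<le> C" by (simp add: prob_space)
    qed (use e in simp)
    also have "\<dots> < 2 * e" using elim(1) by (simp add: proportion_not[OF V(1,2)])
    finally show ?case .
  qed
qed

section \<open>Measurability of the good models\<close>

lemma empirical_distribution_cong:
  assumes "\<And>v g. v \<in> V \<Longrightarrow> x (\<sigma> g v) = y (\<sigma> g v)"
  shows "empirical_distribution V \<sigma> x = empirical_distribution V \<sigma> y"
proof -
  have "pullback_name \<sigma> v x = pullback_name \<sigma> v y" if "v \<in> V" for v
    using assms that by (auto simp: pullback_name_def)
  then show ?thesis by (simp add: empirical_distribution_def cong: sum.cong)
qed

text \<open>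
  Continuity of the empirical distribution in the model.  The models are read off along \<open>d\<close> from
  functions \<open>y\<close> on an auxiliary index type, so that the product topology of a function type can be
  used although models are extensional functions on \<open>V\<close>.
\<close>

lemma open_empirical_distribution:
  fixes \<sigma> :: "'g::countable \<Rightarrow> 'v \<Rightarrow> 'v" and W :: "('g \<Rightarrow> 'x::polish_space) measure set"
  assumes V: "finite V" "V \<noteq> {}" and W: "openin weak_star W"
  shows "open {y :: 'i \<Rightarrow> 'x. empirical_distribution V \<sigma> (\<lambda>v. y (d v)) \<in> W}"
  using W unfolding weak_star_def openin_topology_generated_by_iff
proof induction
  case (Int a b)
  then show ?case by (auto simp: Collect_conj_eq)
next
  case (UN K)
  have "{y :: 'i \<Rightarrow> 'x. empirical_distribution V \<sigma> (\<lambda>v. y (d v)) \<in> \<Union>K}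
      = (\<Union>k\<in>K. {y. empirical_distribution V \<sigma> (\<lambda>v. y (d v)) \<in> k})"
    by auto
  then show ?case using UN by (auto intro: open_UN)
next
  case (Basis s)
  then obtain f :: "('g \<Rightarrow> 'x) \<Rightarrow> real" and U
    where s: "s = {M \<in> Prob. (\<integral>x. f x \<partial>M) \<in> U}" and f: "continuous_on UNIV f" and U: "open U"
    by auto
  have "continuous_on UNIV (\<lambda>y :: 'i \<Rightarrow> 'x. f (\<lambda>g. y (d (\<sigma> g v))))" for v
    by (rule continuous_on_compose2[OF f]) (auto intro!: continuous_intros)
  then have "continuous_on UNIV (\<lambda>y :: 'i \<Rightarrow> 'x. name_average V \<sigma> f (\<lambda>v. y (d v)))"
    unfolding name_average_def pullback_name_def using V by (intro continuous_intros) auto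
  then have "open ((\<lambda>y :: 'i \<Rightarrow> 'x. name_average V \<sigma> f (\<lambda>v. y (d v))) -` U)"
    using U by (intro open_vimage)
  moreover have "{y :: 'i \<Rightarrow> 'x. empirical_distribution V \<sigma> (\<lambda>v. y (d v)) \<in> s}
      = (\<lambda>y. name_average V \<sigma> f (\<lambda>v. y (d v))) -` U"
    by (auto simp: s empirical_distribution_in_Prob[OF V]
        integral_empirical_distribution[OF V borel_measurable_continuous_onI[OF f]])
  ultimately show ?case by simp
qed simp

text \<open>
  Weak-star open sets are arbitrary unions of basic ones, so measurability cannot be checked on
  generators.  Numbering the finite set \<open>V\<close> maps models into \<open>nat \<Rightarrow> 'x\<close>, where the
  product topology is second countable: there the preimage of an open set is open, hence Borel for
  the product \<open>\<sigma>\<close>-algebra.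
\<close>

lemma sets_good_models:
  fixes \<sigma> :: "'g::countable \<Rightarrow> 'v \<Rightarrow> 'v" and W :: "('g \<Rightarrow> 'x::polish_space) measure set"
  assumes V: "finite V" "V \<noteq> {}" and perm: "\<And>g. \<sigma> g permutes V" and W: "openin weak_star W"
  shows "good_models W V \<sigma> \<in> sets (Pi\<^sub>M V (\<lambda>_. borel))"
proof -
  let ?U = "{y :: nat \<Rightarrow> 'x. empirical_distribution V \<sigma> (\<lambda>v. y (to_nat_on V v)) \<in> W}"
  let ?\<Phi> = "\<lambda>(x :: 'v \<Rightarrow> 'x) i. x (from_nat_into V i)"
  have cnt: "countable V" using V by (simp add: countable_finite)
  have "?\<Phi> \<in> Pi\<^sub>M V (\<lambda>_. borel) \<rightarrow>\<^sub>M (borel :: (nat \<Rightarrow> 'x) measure)"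
    using from_nat_into[OF V(2)]
    by (intro measurable_coordinatewise_then_product measurable_component_singleton)
  moreover have "?U \<in> sets borel"
    using open_empirical_distribution[OF V W] by (rule borel_open)
  ultimately have "?\<Phi> -` ?U \<inter> space (Pi\<^sub>M V (\<lambda>_. borel)) \<in> sets (Pi\<^sub>M V (\<lambda>_. borel))"
    by (rule measurable_sets)
  moreover have "empirical_distribution V \<sigma> (\<lambda>v. ?\<Phi> x (to_nat_on V v))
      = empirical_distribution V \<sigma> x" for x
    by (rule empirical_distribution_cong) (simp add: cnt perm permutes_in_image)
  then have "?\<Phi> -` ?U \<inter> space (Pi\<^sub>M V (\<lambda>_. borel)) = good_models W V \<sigma>"
    by (auto simp: good_models_def space_PiM)
  ultimately show ?thesis by simp
qed

section \<open>Concentration of the empirical distribution\<close>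

text \<open>
  For \<open>F\<close> in the orbit hull of \<open>f\<close>, a deviation of at least \<open>e\<close> for \<open>f\<close> forces one of at least
  \<open>e/2\<close> for \<open>F\<close>, hence an average of at least \<open>e/2\<close> for \<open>\<bar>F - c\<bar>\<close>, whose expectation is
  small.
\<close>

lemma name_average_concentrates:
  fixes \<mu> :: "('g::{group_add, countable} \<Rightarrow> 'x::polish_space) measure"
  assumes sofic: "sofic_approximation V \<sigma>" and proc: "metric_process \<mu>"
    and \<mu>s: "\<And>n. n \<ge> 1 \<Longrightarrow> prob_space (\<mu>s n) \<and> sets (\<mu>s n) = sets (Pi\<^sub>M (V n) (\<lambda>_. borel))"
    and erg: "ergodic_process \<mu>" and local: "locally_weak_star_converges V \<sigma> \<mu>s \<mu>"
    and f: "continuous_on UNIV f" "\<And>x. \<bar>f x\<bar> \<le> B" and e: "0 < e" and \<delta>: "0 < \<delta>"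
  shows "\<forall>\<^sub>F n in sequentially. measure (\<mu>s n)
    {x \<in> space (\<mu>s n). e \<le> \<bar>name_average (V n) (\<sigma> n) f x - (\<integral>y. f y \<partial>\<mu>)\<bar>} < \<delta>"
proof -
  define c where "c = (\<integral>y. f y \<partial>\<mu>)"
  have comp: "compact (UNIV :: 'x set)" and \<mu>: "\<mu> \<in> Prob"
    and inv: "\<And>g. distr \<mu> borel (shift g) = \<mu>"
    using proc by (auto simp: metric_process_def)
  \<comment> \<open>The expected average will be below \<open>2 * \<eta>\<close>, so Markov's inequality at level \<open>e/2\<close> gives the
    probability bound \<open>4 * \<eta> / e = \<delta> / 2\<close>.\<close>
  define \<eta> where "\<eta> = \<delta> * e / 8"
  have \<eta>: "0 < \<eta>" using e \<delta> by (simp add: \<eta>_def)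
  obtain F where F: "F \<in> orbit_hull f" "(\<integral>x. \<bar>F x - c\<bar> \<partial>\<mu>) < \<eta>"
    unfolding c_def using ergodic_orbit_hull[OF \<mu> inv erg f \<eta>] by blast
  define h where "h = (\<lambda>x. \<bar>F x - c\<bar>)"
  have h_cont: "continuous_on UNIV h"
    unfolding h_def by (intro continuous_intros orbit_hull_continuous[OF F(1) f(1)])
  have h_meas [measurable]: "h \<in> borel_measurable borel"
    using h_cont by (rule borel_measurable_continuous_onI)
  have f_meas [measurable]: "f \<in> borel_measurable borel"
    using f(1) by (rule borel_measurable_continuous_onI)
  have h_bnd: "\<bar>h x\<bar> \<le> B + \<bar>c\<bar>" for x
    using orbit_hull_bounded[OF F(1) f(2), of x] unfolding h_def by linarith
  have "\<forall>\<^sub>F n in sequentially. (\<integral>x. name_average (V n) (\<sigma> n) h x \<partial>\<mu>s n) < 2 * \<eta>"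
    by (rule expected_name_average_small[OF sofic \<mu> \<mu>s local h_cont h_bnd])
      (use F(2) \<eta> in \<open>simp_all add: h_def\<close>)
  moreover have "\<forall>\<^sub>F n in sequentially. \<forall>x.
      \<bar>name_average (V n) (\<sigma> n) F x - name_average (V n) (\<sigma> n) f x\<bar> < e/2"
    by (rule orbit_hull_name_average[OF sofic comp f F(1)]) (use e in simp)
  ultimately show ?thesis
    using eventually_ge_at_top[of 1]
  proof eventually_elim
    case (elim n)
    note V = sofic_approximation_finite[OF sofic elim(3)]
    interpret prob_space "\<mu>s n" using \<mu>s elim(3) by auto
    have sets: "sets (\<mu>s n) = sets (Pi\<^sub>M (V n) (\<lambda>_. borel))" using \<mu>s elim(3) by auto
    have name: "pullback_name (\<sigma> n) v \<in> \<mu>s n \<rightarrow>\<^sub>M borel" if "v \<in> V n" for v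
      using measurable_pullback_name[of "\<sigma> n", OF V(3) that]
      by (simp add: measurable_cong_sets[OF sets refl])
    have avg_meas: "name_average (V n) (\<sigma> n) k \<in> borel_measurable (\<mu>s n)"
      if k: "k \<in> borel_measurable borel" for k
      unfolding name_average_def
      using measurable_compose[OF name k] by (intro borel_measurable_divide borel_measurable_sum) auto
    note [measurable] = avg_meas[OF h_meas] avg_meas[OF f_meas]
    have V_pos: "real (card (V n)) > 0" using V by (simp add: card_gt_0_iff)
    have avg_h: "\<bar>name_average (V n) (\<sigma> n) F x - c\<bar> \<le> name_average (V n) (\<sigma> n) h x" for x
    proof -
      have "name_average (V n) (\<sigma> n) F x - c
          = (\<Sum>v\<in>V n. F (pullback_name (\<sigma> n) v x) - c) / real (card (V n))"
        using V_pos by (simp add: name_average_def sum_subtractf diff_divide_distrib)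
      also have "\<bar>\<dots>\<bar> \<le> name_average (V n) (\<sigma> n) h x"
        using V_pos sum_abs[of "\<lambda>v. F (pullback_name (\<sigma> n) v x) - c" "V n"]
        by (simp add: name_average_def h_def divide_right_mono)
      finally show ?thesis .
    qed
    have int: "integrable (\<mu>s n) (name_average (V n) (\<sigma> n) h)"
    proof (rule integrable_const_bound[of _ "B + \<bar>c\<bar>"])
      show "AE x in \<mu>s n. norm (name_average (V n) (\<sigma> n) h x) \<le> B + \<bar>c\<bar>"
      proof (rule AE_I2)
        fix x
        have "0 \<le> name_average (V n) (\<sigma> n) h x"
          by (auto simp: name_average_def h_def intro!: divide_nonneg_nonneg sum_nonneg)
        moreover have "(\<Sum>v\<in>V n. h (pullback_name (\<sigma> n) v x)) \<le> real (card (V n)) * (B + \<bar>c\<bar>)"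
          using h_bnd by (intro sum_bounded_above) (auto simp: abs_le_iff)
        then have "name_average (V n) (\<sigma> n) h x \<le> B + \<bar>c\<bar>"
          using V_pos by (simp add: name_average_def field_simps)
        ultimately show "norm (name_average (V n) (\<sigma> n) h x) \<le> B + \<bar>c\<bar>" by simp
      qed
    qed measurable
    have "measure (\<mu>s n) {x \<in> space (\<mu>s n). e \<le> \<bar>name_average (V n) (\<sigma> n) f x - c\<bar>}
        \<le> measure (\<mu>s n) {x \<in> space (\<mu>s n). e/2 \<le> name_average (V n) (\<sigma> n) h x}"
    proof (rule finite_measure_mono)
      show "{x \<in> space (\<mu>s n). e \<le> \<bar>name_average (V n) (\<sigma> n) f x - c\<bar>}
          \<subseteq> {x \<in> space (\<mu>s n). e/2 \<le> name_average (V n) (\<sigma> n) h x}"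
      proof safe
        fix x assume "e \<le> \<bar>name_average (V n) (\<sigma> n) f x - c\<bar>"
        then show "e/2 \<le> name_average (V n) (\<sigma> n) h x"
          using avg_h[of x] elim(2)[rule_format, of x] by linarith
      qed
    qed measurable
    also have "\<dots> \<le> (\<integral>x. name_average (V n) (\<sigma> n) h x \<partial>\<mu>s n) / (e/2)"
      by (rule integral_Markov_inequality_measure[OF int, of "{}"])
        (use e avg_h in \<open>auto intro: order_trans[OF abs_ge_zero]\<close>)
    also have "\<dots> < 2 * \<eta> / (e/2)" using elim(1) e by (intro divide_strict_right_mono) auto
    also have "\<dots> < \<delta>" using e \<delta> by (simp add: \<eta>_def field_simps)
    finally show ?case by (simp add: c_def)
  qed
qed

text \<open>
  Induction over the generation of the topology.  An open set containing \<open>\<mu>\<close> that arises as a union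
  has a member containing \<open>\<mu>\<close>, and an intersection splits \<open>\<delta>\<close> in two halves.
\<close>

lemma good_models_concentrate:
  fixes \<mu> :: "('g::{group_add, countable} \<Rightarrow> 'x::polish_space) measure"
  assumes sofic: "sofic_approximation V \<sigma>" and proc: "metric_process \<mu>"
    and \<mu>s: "\<And>n. n \<ge> 1 \<Longrightarrow> prob_space (\<mu>s n) \<and> sets (\<mu>s n) = sets (Pi\<^sub>M (V n) (\<lambda>_. borel))"
    and erg: "ergodic_process \<mu>" and local: "locally_weak_star_converges V \<sigma> \<mu>s \<mu>"
    and W: "openin weak_star W" "\<mu> \<in> W" and \<delta>: "0 < \<delta>"
  shows "\<forall>\<^sub>F n in sequentially. 1 - \<delta> < measure (\<mu>s n) (good_models W (V n) (\<sigma> n))"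
proof -
  have meas: "good_models W (V n) (\<sigma> n) \<in> sets (\<mu>s n)" if "n \<ge> 1" "openin weak_star W" for n W
    using sets_good_models[of "V n" "\<sigma> n", OF sofic_approximation_finite[OF sofic that(1)] that(2)]
      \<mu>s[OF that(1)] by simp
  have "generate_topology_on {{M \<in> Prob. (\<integral>x. f x \<partial>M) \<in> U} | (f :: ('g \<Rightarrow> 'x) \<Rightarrow> real) U.
      continuous_on UNIV f \<and> bounded (range f) \<and> open U} W"
    (is "generate_topology_on ?S W")
    using W(1) by (simp add: weak_star_def openin_topology_generated_by_iff)
  then show ?thesis using W(2) \<delta>
  proof (induction W arbitrary: \<delta>)
    case (Int a b)
    have open_ab: "openin weak_star a" "openin weak_star b"
      using Int.hyps by (simp_all add: weak_star_def openin_topology_generated_by_iff)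
    have "\<forall>\<^sub>F n in sequentially. 1 - \<delta>/2 < measure (\<mu>s n) (good_models a (V n) (\<sigma> n))"
      "\<forall>\<^sub>F n in sequentially. 1 - \<delta>/2 < measure (\<mu>s n) (good_models b (V n) (\<sigma> n))"
      using Int by auto
    then show ?case using eventually_ge_at_top[of 1]
    proof eventually_elim
      case (elim n)
      interpret prob_space "\<mu>s n" using \<mu>s elim(3) by auto
      let ?A = "good_models a (V n) (\<sigma> n)" and ?B = "good_models b (V n) (\<sigma> n)"
      have sets: "?A \<in> events" "?B \<in> events" using meas open_ab elim(3) by auto
      have inter: "good_models (a \<inter> b) (V n) (\<sigma> n) = ?A \<inter> ?B"
        by (auto simp: good_models_def)
      have "prob (?A \<union> ?B) = prob ?A + prob ?B - prob (?A \<inter> ?B)"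
        using sets by (intro measure_Un3) (simp_all add: fmeasurable_eq_sets)
      with elim(1,2) prob_le_1[of "?A \<union> ?B"] show ?case unfolding inter by linarith
    qed
  next
    case (UN K)
    then obtain k where k: "k \<in> K" "\<mu> \<in> k" by auto
    have "openin weak_star (\<Union>K)"
      using UN.hyps by (auto simp: weak_star_def openin_topology_generated_by_iff
          intro: generate_topology_on.UN)
    have "\<forall>\<^sub>F n in sequentially. 1 - \<delta> < measure (\<mu>s n) (good_models k (V n) (\<sigma> n))"
      using UN k by auto
    then show ?case using eventually_ge_at_top[of 1]
    proof eventually_elim
      case (elim n)
      interpret prob_space "\<mu>s n" using \<mu>s elim(2) by auto
      have "prob (good_models k (V n) (\<sigma> n)) \<le> prob (good_models (\<Union>K) (V n) (\<sigma> n))"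
        using meas[OF elim(2) \<open>openin weak_star (\<Union>K)\<close>] k(1)
        by (intro finite_measure_mono) (auto simp: good_models_def)
      with elim(1) show ?case by simp
    qed
  next
    case (Basis s)
    then obtain f :: "('g \<Rightarrow> 'x) \<Rightarrow> real" and U
      where s: "s = {M \<in> Prob. (\<integral>x. f x \<partial>M) \<in> U}" and f: "continuous_on UNIV f"
        and bnd: "bounded (range f)" and U: "open U"
      by auto
    obtain B where B: "\<And>x. \<bar>f x\<bar> \<le> B" using bnd by (auto simp: bounded_iff)
    obtain e where e: "0 < e" "ball (\<integral>x. f x \<partial>\<mu>) e \<subseteq> U"
      using U Basis.prems(1) by (auto simp: s open_contains_ball)
    have "openin weak_star s"
      using Basis.hyps by (simp add: weak_star_def topology_generated_by_Basis)
    have "\<forall>\<^sub>F n in sequentially. measure (\<mu>s n)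
        {x \<in> space (\<mu>s n). e \<le> \<bar>name_average (V n) (\<sigma> n) f x - (\<integral>y. f y \<partial>\<mu>)\<bar>} < \<delta>"
      by (rule name_average_concentrates[OF sofic proc \<mu>s erg local f B e(1) Basis.prems(2)])
    then show ?case using eventually_ge_at_top[of 1]
    proof eventually_elim
      case (elim n)
      note V = sofic_approximation_finite[OF sofic elim(2)]
      interpret prob_space "\<mu>s n" using \<mu>s elim(2) by auto
      let ?bad = "{x \<in> space (\<mu>s n). e \<le> \<bar>name_average (V n) (\<sigma> n) f x - (\<integral>y. f y \<partial>\<mu>)\<bar>}"
      let ?G = "good_models s (V n) (\<sigma> n)"
      have G: "?G \<in> events" using meas elim(2) \<open>openin weak_star s\<close> by auto
      have space: "space (\<mu>s n) = V n \<rightarrow>\<^sub>E UNIV"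
        using sets_eq_imp_space_eq[of "\<mu>s n"] \<mu>s[OF elim(2)] by (auto simp: space_PiM)
      have "space (\<mu>s n) - ?G \<subseteq> ?bad"
      proof
        fix x assume x: "x \<in> space (\<mu>s n) - ?G"
        then have "name_average (V n) (\<sigma> n) f x \<notin> U"
          using integral_empirical_distribution[OF V(1,2) borel_measurable_continuous_onI[OF f]]
          by (auto simp: good_models_def space s empirical_distribution_in_Prob[OF V(1,2)])
        with e(2) have "name_average (V n) (\<sigma> n) f x \<notin> ball (\<integral>x. f x \<partial>\<mu>) e" by auto
        with x show "x \<in> ?bad" by (auto simp: dist_real_def abs_minus_commute)
      qed
      moreover have "?bad \<in> events"
      proof -
        have [measurable]: "f \<in> borel_measurable borel"
          using f by (rule borel_measurable_continuous_onI)
        have [measurable]: "pullback_name (\<sigma> n) v \<in> \<mu>s n \<rightarrow>\<^sub>M borel" if "v \<in> V n" for v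
          using measurable_pullback_name[of "\<sigma> n", OF V(3) that] \<mu>s[OF elim(2)]
          by (simp cong: measurable_cong_sets)
        show ?thesis unfolding name_average_def by measurable
      qed
      ultimately have "prob (space (\<mu>s n) - ?G) \<le> prob ?bad"
        by (rule finite_measure_mono)
      then show ?case using elim(1) prob_compl[OF G] by simp
    qed
  qed simp
qed

section \<open>Quenched convergence\<close>

theorem corollary5p7:
  fixes V :: "nat \<Rightarrow> 'v set"
    and \<sigma> :: "nat \<Rightarrow> 'g::{group_add, countable} \<Rightarrow> 'v \<Rightarrow> 'v"
    and \<mu> :: "('g \<Rightarrow> 'x::polish_space) measure"
    and \<mu>s :: "nat \<Rightarrow> ('v \<Rightarrow> 'x) measure"
  assumes "sofic_approximation V \<sigma>"
    and "metric_process \<mu>"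
    and "\<And>n. n \<ge> 1 \<Longrightarrow> prob_space (\<mu>s n) \<and> sets (\<mu>s n) = sets (Pi\<^sub>M (V n) (\<lambda>_. borel))"
    and "ergodic_process \<mu>"
    and "locally_weak_star_converges V \<sigma> \<mu>s \<mu>"
  shows "quenched_converges V \<sigma> \<mu>s \<mu>"
  unfolding quenched_converges_def
proof (intro conjI allI impI)
  show "locally_weak_star_converges V \<sigma> \<mu>s \<mu>" by fact
  fix W :: "('g \<Rightarrow> 'x) measure set" assume W: "openin weak_star W \<and> \<mu> \<in> W"
  show "(\<lambda>n. measure (\<mu>s n) (good_models W (V n) (\<sigma> n))) \<longlonglongrightarrow> 1"
  proof (rule order_tendstoI)
    fix a :: real assume "a < 1"
    then show "\<forall>\<^sub>F n in sequentially. a < measure (\<mu>s n) (good_models W (V n) (\<sigma> n))"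
      using good_models_concentrate[OF assms, of W "1 - a"] W by simp
  next
    fix a :: real assume a: "1 < a"
    show "\<forall>\<^sub>F n in sequentially. measure (\<mu>s n) (good_models W (V n) (\<sigma> n)) < a"
      using eventually_ge_at_top[of 1]
    proof eventually_elim
      case (elim n)
      then show ?case
        using prob_space.prob_le_1[of "\<mu>s n" "good_models W (V n) (\<sigma> n)"] assms(3) a by fastforce
    qed
  qed
qed

end
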